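(* Let $(x_k)$ be a sester-basic sequence in a Banach lattice $X$ with basis constant $K$; let $(y_k)$ be a sequence in $X$ such that $$2K\sum_{k=1}^\infty\frac{\|x_k-y_k\|}{\|x_k\|}<1.$$ Then $(y_k)$ is sester-basic.
   Context: The basis constant of a Schauder basic sequence $(x_k)$ is the least $K$ with $\|\sum_{k=1}^n\alpha_kx_k\|\le K\|\sum_{k=1}^m\alpha_kx_k\|$ for all $n\le m$ and all scalars. A sequence $(z_n)$ converges in order to $z$ in a vector lattice $X$ if there is a net $(u_\gamma)$ in $X$ with $u_\gamma\downarrow0$ such that for every $\gamma$ there is $n_0$ with $|z_n-z|\le u_\gamma$ for all $n\ge n_0$. A series $\sum\alpha_kx_k$ converges in order to $x$ if its partial sums do. A sequence $(x_k)$ of non-zero vectors in $X$ is bibasic if there is $M\ge1$ with $\bigl\|\bigvee_{n=1}^m|\sum_{k=1}^n\alpha_kx_k|\bigr\|\le M\bigl\|\sum_{k=1}^m\alpha_kx_k\bigr\|$ for all $m$ and all scalars; equivalently, it is Schauder basic and for every norm convergent series $\sum_k\alpha_kx_k$ the partial sums converge in order to the same sum. It has unique order expansions if, whenever $\sum\alpha_kx_k$ and $\sum\beta_kx_k$ converge in order to the same vector, $\alpha_k=\beta_k$ for all $k$. For a bibasic sequence, $[x_k]$ denotes its closed linear span and $[x_k]^o$ the set of all $x\in X$ to which some series $\sum_k\alpha_kx_k$ converges in order (so $[x_k]\subseteq[x_k]^o$). A sequence $(x_k)$ in $X$ is sester-basic if it is bibasic, has unique order expansions, and $[x_k]=[x_k]^o$.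 *)

theory Defs
  imports "HOL-Analysis.Analysis" "HOL-Library.Lattice_Algebras"
begin

class banach_lattice = banach + ordered_real_vector + lattice_ab_group_add_abs +
  assumes norm_le_of_abs_le: "\<bar>x\<bar> \<le> \<bar>y\<bar> \<Longrightarrow> norm x \<le> norm y"

instance real :: banach_lattice
  by standard simp

definition net_decreasing_to_zero ::
    "'i set \<Rightarrow> ('i \<Rightarrow> 'i \<Rightarrow> bool) \<Rightarrow> ('i \<Rightarrow> 'a::{order,zero}) \<Rightarrow> bool" where
  "net_decreasing_to_zero I le u \<longleftrightarrow>
     I \<noteq> {} \<and>
     (\<forall>i\<in>I. le i i) \<and>
     (\<forall>i\<in>I. \<forall>j\<in>I. \<forall>k\<in>I. le i j \<longrightarrow> le j k \<longrightarrow> le i k) \<and>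
     (\<forall>i\<in>I. \<forall>j\<in>I. \<exists>k\<in>I. le i k \<and> le j k) \<and>
     (\<forall>i\<in>I. \<forall>j\<in>I. le i j \<longrightarrow> u j \<le> u i) \<and>
     (\<forall>i\<in>I. 0 \<le> u i) \<and>
     (\<forall>w. (\<forall>i\<in>I. w \<le> u i) \<longrightarrow> w \<le> 0)"

text \<open>A definition cannot quantify over the index type of the net, so the indices are
  taken in the space itself. This is no restriction, since a decreasing net can be re-indexed by
  its range: see \<open>order_convergesI\<close>, where the index type is arbitrary.\<close>

definition order_converges :: "(nat \<Rightarrow> 'a::banach_lattice) \<Rightarrow> 'a \<Rightarrow> bool" where
  "order_converges z l \<longleftrightarrow>
     (\<exists>(I :: 'a set) le u. net_decreasing_to_zero I le u \<and>
        (\<forall>i\<in>I. \<exists>n0. \<forall>n\<ge>n0. \<bar>z n - l\<bar> \<le> u i))"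

lemma order_convergesI:
  fixes I :: "'i set" and u :: "'i \<Rightarrow> 'a::banach_lattice"
  assumes net: "net_decreasing_to_zero I le u"
    and dom: "\<And>i. i \<in> I \<Longrightarrow> \<exists>n0. \<forall>n\<ge>n0. \<bar>z n - l\<bar> \<le> u i"
  shows "order_converges z l"
proof -
  have dir: "\<exists>k\<in>I. u k \<le> u i \<and> u k \<le> u j" if ij: "i \<in> I" "j \<in> I" for i j
  proof -
    obtain k where "k \<in> I" "le i k" "le j k"
      using net ij unfolding net_decreasing_to_zero_def by blast
    moreover have "\<forall>i\<in>I. \<forall>j\<in>I. le i j \<longrightarrow> u j \<le> u i"
      using net unfolding net_decreasing_to_zero_def by blast
    ultimately show ?thesis
      using ij by blast
  qed
  have inf: "I \<noteq> {}" "\<forall>i\<in>I. 0 \<le> u i" "\<forall>w. (\<forall>i\<in>I. w \<le> u i) \<longrightarrow> w \<le> 0"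
    using net unfolding net_decreasing_to_zero_def by simp_all
  have "net_decreasing_to_zero (u ` I) (\<lambda>v w. w \<le> v) (\<lambda>v. v)"
    unfolding net_decreasing_to_zero_def ball_simps bex_simps
    by (intro conjI ballI impI; use inf dir in simp)
  moreover have "\<forall>v\<in>u ` I. \<exists>n0. \<forall>n\<ge>n0. \<bar>z n - l\<bar> \<le> v"
    using dom by simp
  ultimately show ?thesis
    unfolding order_converges_def by (intro exI conjI)
qed

text \<open>Sequences are indexed from 0, so that the sum over \<open>k \<le> n\<close> consists of
  the first \<open>n + 1\<close> terms; every nonempty initial segment is of this form.\<close>

definition series_order_converges ::
    "(nat \<Rightarrow> real) \<Rightarrow> (nat \<Rightarrow> 'a::banach_lattice) \<Rightarrow> 'a \<Rightarrow> bool" where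
  "series_order_converges a x l \<longleftrightarrow> order_converges (\<lambda>n. \<Sum>k\<le>n. a k *\<^sub>R x k) l"

definition basis_bound :: "(nat \<Rightarrow> 'a::real_normed_vector) \<Rightarrow> real \<Rightarrow> bool" where
  "basis_bound x K \<longleftrightarrow>
     (\<forall>(a :: nat \<Rightarrow> real) n m. n \<le> m \<longrightarrow>
        norm (\<Sum>k\<le>n. a k *\<^sub>R x k) \<le> K * norm (\<Sum>k\<le>m. a k *\<^sub>R x k))"

definition is_basis_constant :: "(nat \<Rightarrow> 'a::real_normed_vector) \<Rightarrow> real \<Rightarrow> bool" where
  "is_basis_constant x K \<longleftrightarrow> basis_bound x K \<and> (\<forall>K'. basis_bound x K' \<longrightarrow> K \<le> K')"

definition bibasic :: "(nat \<Rightarrow> 'a::banach_lattice) \<Rightarrow> bool" where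
  "bibasic x \<longleftrightarrow>
     (\<forall>k. x k \<noteq> 0) \<and>
     (\<exists>M\<ge>1. \<forall>(a :: nat \<Rightarrow> real) m.
        norm (Sup_fin ((\<lambda>n. \<bar>\<Sum>k\<le>n. a k *\<^sub>R x k\<bar>) ` {..m}))
          \<le> M * norm (\<Sum>k\<le>m. a k *\<^sub>R x k))"

definition unique_order_expansions :: "(nat \<Rightarrow> 'a::banach_lattice) \<Rightarrow> bool" where
  "unique_order_expansions x \<longleftrightarrow>
     (\<forall>a b l. series_order_converges a x l \<longrightarrow> series_order_converges b x l \<longrightarrow>
        (\<forall>k. a k = b k))"

definition closed_span :: "(nat \<Rightarrow> 'a::real_normed_vector) \<Rightarrow> 'a set" where
  "closed_span x = closure (span (range x))"

definition order_span :: "(nat \<Rightarrow> 'a::banach_lattice) \<Rightarrow> 'a set" where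
  "order_span x = {l. \<exists>a. series_order_converges a x l}"

definition sester_basic :: "(nat \<Rightarrow> 'a::banach_lattice) \<Rightarrow> bool" where
  "sester_basic x \<longleftrightarrow> bibasic x \<and> unique_order_expansions x \<and> closed_span x = order_span x"

end

theory Submission
  imports Defs
begin

text \<open>For \<open>j \<le> m\<close> one has
  \<open>norm (a j *\<^sub>R x j) \<le> 2 * K * norm (\<Sum>k\<le>m. a k *\<^sub>R x k)\<close>, so replacing \<open>x\<close> by \<open>y\<close>
  changes a finite sum, and also the supremum of the moduli of its partial sums, by at most a fixed
  fraction of the norm of the sum; hence \<open>y\<close> is bibasic. If \<open>\<Sum>k. a k *\<^sub>R y k\<close> converges in order
  to \<open>l\<close>, its terms are norm bounded, so \<open>\<Sum>k. a k *\<^sub>R (x k - y k)\<close> converges absolutely, to \<open>d\<close>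
  say, both in norm and in order. Then \<open>\<Sum>k. a k *\<^sub>R x k\<close> converges in order to \<open>l + d\<close>, which lies
  in the closed span of \<open>x\<close> and so has a norm convergent expansion; by uniqueness this is the given
  one. So the original series converges to \<open>l\<close> in norm, and both remaining properties of \<open>y\<close>
  follow from those of Schauder basic sequences.\<close>

section \<open>Banach lattices and order convergence\<close>

lemma norm_abs [simp]: "norm \<bar>x\<bar> = norm (x :: 'a::banach_lattice)"
  by (intro antisym norm_le_of_abs_le) simp_all

lemma norm_mono_nonneg:
  fixes x y :: "'a::banach_lattice"
  assumes "0 \<le> x" "x \<le> y"
  shows "norm x \<le> norm y"
proof (rule norm_le_of_abs_le)
  have "0 \<le> y" using assms by (rule order_trans)
  then show "\<bar>x\<bar> \<le> \<bar>y\<bar>"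
    using assms by simp
qed

text \<open>The reverse triangle inequality holds in the lattice order, so monotonicity of the norm
  makes the modulus non-expansive.\<close>

lemma tendsto_lattice_abs:
  fixes f :: "'b \<Rightarrow> 'a::banach_lattice"
  assumes "(f \<longlongrightarrow> l) F"
  shows "((\<lambda>n. \<bar>f n\<bar>) \<longlongrightarrow> \<bar>l\<bar>) F"
proof -
  have "norm (\<bar>f n\<bar> - \<bar>l\<bar>) \<le> norm (f n - l)" for n
    by (intro norm_le_of_abs_le abs_triangle_ineq3)
  then have "((\<lambda>n. \<bar>f n\<bar> - \<bar>l\<bar>) \<longlongrightarrow> 0) F"
    by (intro Lim_null_comparison[OF always_eventually tendsto_norm_zero[OF LIM_zero[OF assms]]]) blast
  then show ?thesis
    by (rule LIM_zero_cancel)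
qed

text \<open>The positive cone is norm closed: it is the set where \<open>\<bar>v\<bar> = v\<close>,
  and the modulus is continuous.\<close>

lemma LIMSEQ_lattice_le:
  fixes f g :: "nat \<Rightarrow> 'a::banach_lattice"
  assumes f: "f \<longlonglongrightarrow> l" and g: "g \<longlonglongrightarrow> l'" and le: "\<And>n. n \<ge> N \<Longrightarrow> f n \<le> g n"
  shows "l \<le> l'"
proof -
  have lim: "(\<lambda>n. g n - f n) \<longlonglongrightarrow> l' - l"
    by (intro tendsto_diff f g)
  have "\<forall>\<^sub>F n in sequentially. \<bar>g n - f n\<bar> = g n - f n"
    by (intro eventually_sequentiallyI[of N]) (simp add: le)
  then have "(\<lambda>n. g n - f n) \<longlonglongrightarrow> \<bar>l' - l\<bar>"
    using tendsto_lattice_abs[OF lim] by (simp cong: tendsto_cong)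
  then have "\<bar>l' - l\<bar> = l' - l"
    using lim LIMSEQ_unique by blast
  then show ?thesis
    by (metis abs_ge_zero diff_ge_0_iff_ge)
qed

lemma net_decreasing_to_zeroD:
  assumes "net_decreasing_to_zero I le u"
  shows "I \<noteq> {}"
    and "\<forall>i\<in>I. le i i"
    and "\<forall>i\<in>I. \<forall>j\<in>I. \<forall>k\<in>I. le i j \<longrightarrow> le j k \<longrightarrow> le i k"
    and "\<forall>i\<in>I. \<forall>j\<in>I. \<exists>k\<in>I. le i k \<and> le j k"
    and "\<forall>i\<in>I. \<forall>j\<in>I. le i j \<longrightarrow> u j \<le> u i"
    and "\<forall>i\<in>I. 0 \<le> u i"
    and "\<forall>w. (\<forall>i\<in>I. w \<le> u i) \<longrightarrow> w \<le> 0"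
  using assms unfolding net_decreasing_to_zero_def by - (elim conjE, assumption)+

text \<open>The dominating nets are added over the product of their index sets. The new indices are
  pairs, which \<open>order_convergesI\<close> permits.\<close>

lemma order_converges_add:
  fixes z z' :: "nat \<Rightarrow> 'a::banach_lattice"
  assumes "order_converges z l" "order_converges z' l'"
  shows "order_converges (\<lambda>n. z n + z' n) (l + l')"
proof -
  obtain I :: "'a set" and le u where net: "net_decreasing_to_zero I le u"
    and dom: "\<forall>i\<in>I. \<exists>n0. \<forall>n\<ge>n0. \<bar>z n - l\<bar> \<le> u i"
    using assms(1) unfolding order_converges_def by blast
  obtain J :: "'a set" and le' u' where net': "net_decreasing_to_zero J le' u'"
    and dom': "\<forall>i\<in>J. \<exists>n0. \<forall>n\<ge>n0. \<bar>z' n - l'\<bar> \<le> u' i"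
    using assms(2) unfolding order_converges_def by blast
  show ?thesis
  proof (rule order_convergesI)
    \<comment> \<open>An iterated infimum: for fixed \<open>i\<close>, the vector
      \<open>w - u i\<close> is a lower bound of \<open>u'\<close>, so \<open>w\<close> is a lower
      bound of \<open>u\<close>.\<close>
    have inf: "w \<le> 0" if "\<forall>i\<in>I. \<forall>j\<in>J. w \<le> u i + u' j" for w
    proof -
      have "w \<le> u i" if i: "i \<in> I" for i
      proof -
        have "\<forall>j\<in>J. w - u i \<le> u' j"
          using \<open>\<forall>i\<in>I. \<forall>j\<in>J. w \<le> u i + u' j\<close> i by (simp add: diff_le_eq add.commute)
        then have "w - u i \<le> 0"
          using net' unfolding net_decreasing_to_zero_def by blast
        then show ?thesis by simp
      qed
      then show ?thesis
        using net unfolding net_decreasing_to_zero_def by blast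
    qed
    note D = net_decreasing_to_zeroD[OF net, rule_format]
      and D' = net_decreasing_to_zeroD[OF net', rule_format]
    show "net_decreasing_to_zero (I \<times> J)
        (\<lambda>p q. le (fst p) (fst q) \<and> le' (snd p) (snd q)) (\<lambda>p. u (fst p) + u' (snd p))"
      unfolding net_decreasing_to_zero_def
    proof (intro conjI ballI impI allI)
      fix p q assume "p \<in> I \<times> J" "q \<in> I \<times> J"
      then show "\<exists>r\<in>I \<times> J. (le (fst p) (fst r) \<and> le' (snd p) (snd r)) \<and>
          le (fst q) (fst r) \<and> le' (snd q) (snd r)"
        using D(4)[of "fst p" "fst q"] D'(4)[of "snd p" "snd q"] by fastforce
    next
      show "I \<times> J \<noteq> {}"
        using D(1) D'(1) by blast
    next
      fix p q r assume "p \<in> I \<times> J" "q \<in> I \<times> J" "r \<in> I \<times> J"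
        "le (fst p) (fst q) \<and> le' (snd p) (snd q)" "le (fst q) (fst r) \<and> le' (snd q) (snd r)"
      then show "le (fst p) (fst r)" "le' (snd p) (snd r)"
        using D(3)[of "fst p" "fst q" "fst r"] D'(3)[of "snd p" "snd q" "snd r"] by auto
    qed (use inf in \<open>auto intro!: add_mono add_nonneg_nonneg D(2,5,6) D'(2,5,6)\<close>)
  next
    fix p assume p: "p \<in> I \<times> J"
    obtain n0 where n0: "\<forall>n\<ge>n0. \<bar>z n - l\<bar> \<le> u (fst p)"
      using dom p by fastforce
    obtain n1 where n1: "\<forall>n\<ge>n1. \<bar>z' n - l'\<bar> \<le> u' (snd p)"
      using dom' p by fastforce
    have "\<bar>z n + z' n - (l + l')\<bar> \<le> u (fst p) + u' (snd p)" if "n \<ge> max n0 n1" for n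
    proof -
      have "\<bar>z n + z' n - (l + l')\<bar> = \<bar>(z n - l) + (z' n - l')\<bar>"
        by (simp add: algebra_simps)
      also have "\<dots> \<le> \<bar>z n - l\<bar> + \<bar>z' n - l'\<bar>"
        by (rule abs_triangle_ineq)
      also have "\<dots> \<le> u (fst p) + u' (snd p)"
        using n0 n1 that by (intro add_mono) auto
      finally show ?thesis .
    qed
    then show "\<exists>n0. \<forall>n\<ge>n0. \<bar>z n + z' n - (l + l')\<bar> \<le> u (fst p) + u' (snd p)"
      by blast
  qed
qed

text \<open>A single member of the dominating net suffices, since it eventually bounds the deviation
  from \<open>l\<close>.\<close>

lemma order_converges_imp_Bseq:
  fixes z :: "nat \<Rightarrow> 'a::banach_lattice"
  assumes "order_converges z l"
  shows "Bseq z"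
proof -
  obtain I :: "'a set" and le u where net: "net_decreasing_to_zero I le u"
    and dom: "\<forall>i\<in>I. \<exists>n0. \<forall>n\<ge>n0. \<bar>z n - l\<bar> \<le> u i"
    using assms unfolding order_converges_def by blast
  obtain i where i: "i \<in> I" "0 \<le> u i"
    using net unfolding net_decreasing_to_zero_def by blast
  then obtain n0 where n0: "\<forall>n\<ge>n0. \<bar>z n - l\<bar> \<le> u i"
    using dom by blast
  have "norm (z n) \<le> norm (u i) + norm l" if "n \<ge> n0" for n
  proof -
    have "norm (z n - l) \<le> norm (u i)"
      using n0 that i(2) by (intro norm_le_of_abs_le) simp
    then show ?thesis
      using norm_triangle_ineq[of "z n - l" l] by simp
  qed
  then have "\<forall>\<^sub>F n in sequentially. norm (z n) \<le> norm (norm (u i) + norm l)"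
    by (auto simp: eventually_sequentially)
  then show ?thesis
    by (rule Bseq_eventually_mono) simp
qed

lemma sum_le_suminf_lattice:
  fixes c :: "nat \<Rightarrow> 'a::banach_lattice"
  assumes "summable c" "\<And>k. 0 \<le> c k"
  shows "sum c {..<n} \<le> suminf c"
proof (rule LIMSEQ_lattice_le[OF tendsto_const summable_LIMSEQ[OF assms(1)]])
  show "sum c {..<n} \<le> sum c {..<m}" if "m \<ge> n" for m
    using that assms(2) by (intro sum_mono2) auto
qed

text \<open>The tails of \<open>c\<close> decrease and tend to 0 in norm; since the cone is closed,
  none of their lower bounds can fail to be \<le> 0. They thus serve as a dominating net indexed by
  the natural numbers.\<close>

lemma order_converges_tail:
  fixes c :: "nat \<Rightarrow> 'a::banach_lattice"
  assumes c: "summable c" "\<And>k. 0 \<le> c k"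
    and dom: "\<And>i. \<exists>n0. \<forall>n\<ge>n0. \<bar>z n - l\<bar> \<le> suminf c - sum c {..<i}"
  shows "order_converges z l"
proof (rule order_convergesI)
  define t where "t i = suminf c - sum c {..<i}" for i
  have t0: "t \<longlonglongrightarrow> 0"
    unfolding t_def using tendsto_diff[OF tendsto_const summable_LIMSEQ[OF c(1)], of "suminf c"]
    by simp
  show "net_decreasing_to_zero UNIV (\<le>) t"
    unfolding net_decreasing_to_zero_def
  proof (intro conjI ballI allI impI)
    fix i j :: nat assume "i \<le> j"
    then show "t j \<le> t i"
      unfolding t_def using c(2) by (intro diff_left_mono sum_mono2) auto
  next
    fix i j :: nat
    show "\<exists>k\<in>UNIV. i \<le> k \<and> j \<le> k"
      by (intro bexI[of _ "max i j"]) auto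
  next
    fix i show "0 \<le> t i"
      unfolding t_def using sum_le_suminf_lattice[OF c] by simp
  next
    fix w assume "\<forall>i\<in>UNIV. w \<le> t i"
    then show "w \<le> 0"
      by (intro LIMSEQ_lattice_le[OF tendsto_const t0]) auto
  qed auto
  show "\<exists>n0. \<forall>n\<ge>n0. \<bar>z n - l\<bar> \<le> t i" for i
    unfolding t_def by (rule dom)
qed

text \<open>The errors are dominated by the tails of the series of moduli. This is checked on finite
  sums up to \<open>p\<close> and survives the norm limit in \<open>p\<close>.\<close>

lemma order_converges_absolutely:
  fixes d :: "nat \<Rightarrow> 'a::banach_lattice"
  assumes "summable (\<lambda>k. norm (d k))"
  shows "order_converges (\<lambda>n. \<Sum>k\<le>n. d k) (suminf d)"
proof (rule order_converges_tail)
  have d: "summable d"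
    using assms by (rule summable_norm_cancel)
  show ad: "summable (\<lambda>k. \<bar>d k\<bar>)"
    using assms by (intro summable_norm_cancel[of "\<lambda>k. \<bar>d k\<bar>"]) simp
  have tail: "\<bar>sum d {..n} - suminf d\<bar> \<le> (\<Sum>k. \<bar>d k\<bar>) - (\<Sum>k<i. \<bar>d k\<bar>)" if "n \<ge> i" for n i
  proof (rule LIMSEQ_lattice_le)
    show "(\<lambda>p. \<bar>sum d {..n} - sum d {..<p}\<bar>) \<longlonglongrightarrow> \<bar>sum d {..n} - suminf d\<bar>"
      by (intro tendsto_lattice_abs tendsto_diff tendsto_const summable_LIMSEQ d)
    show "(\<lambda>p. (\<Sum>k<p. \<bar>d k\<bar>) - (\<Sum>k<i. \<bar>d k\<bar>)) \<longlonglongrightarrow> (\<Sum>k. \<bar>d k\<bar>) - (\<Sum>k<i. \<bar>d k\<bar>)"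
      by (intro tendsto_diff tendsto_const summable_LIMSEQ ad)
    fix p assume p: "p \<ge> Suc n"
    have "\<bar>sum d {..n} - sum d {..<p}\<bar> = \<bar>sum d {..<p} - sum d {..n}\<bar>"
      by (rule abs_minus_commute)
    also have "sum d {..<p} - sum d {..n} = sum d ({..<p} - {..n})"
      using p by (intro sum_diff[symmetric]) auto
    also have "\<bar>\<dots>\<bar> \<le> (\<Sum>k\<in>{..<p} - {..n}. \<bar>d k\<bar>)"
      by (rule sum_abs)
    also have "\<dots> \<le> (\<Sum>k\<in>{..<p} - {..<i}. \<bar>d k\<bar>)"
      using that by (intro sum_mono2) auto
    also have "\<dots> = (\<Sum>k<p. \<bar>d k\<bar>) - (\<Sum>k<i. \<bar>d k\<bar>)"
      using p that by (intro sum_diff) auto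
    finally show "\<bar>sum d {..n} - sum d {..<p}\<bar> \<le> (\<Sum>k<p. \<bar>d k\<bar>) - (\<Sum>k<i. \<bar>d k\<bar>)" .
  qed
  then show "\<exists>n0. \<forall>n\<ge>n0. \<bar>sum d {..n} - suminf d\<bar> \<le> (\<Sum>k. \<bar>d k\<bar>) - (\<Sum>k<i. \<bar>d k\<bar>)" for i
    by blast
qed simp

section \<open>Schauder basic sequences\<close>

lemma basis_boundD:
  assumes "basis_bound x K" "n \<le> m"
  shows "norm (\<Sum>k\<le>n. a k *\<^sub>R x k) \<le> K * norm (\<Sum>k\<le>m. a k *\<^sub>R x k)"
  using assms unfolding basis_bound_def by simp

text \<open>A term is the difference of two consecutive partial sums, whence the factor 2.\<close>

lemma basis_bound_term:
  assumes "basis_bound x K" "k \<le> m"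
  shows "norm (a k *\<^sub>R x k) \<le> 2 * K * norm (\<Sum>k\<le>m. a k *\<^sub>R x k)"
proof -
  let ?S = "\<lambda>n. \<Sum>k\<le>n. a k *\<^sub>R x k"
  have S: "norm (?S n) \<le> K * norm (?S m)" if "n \<le> m" for n
    by (rule basis_boundD[OF assms(1) that])
  show ?thesis
  proof (cases k)
    \<comment> \<open>No partial sum precedes this one. Doubling the bound is harmless: it dominates
      a norm, so it is non-negative even though no sign of \<open>K\<close> is assumed.\<close>
    case 0
    then show ?thesis
      using S[of 0] norm_ge_zero[of "?S 0"] by (simp del: norm_ge_zero norm_scaleR)
  next
    case (Suc j)
    have "norm (a k *\<^sub>R x k) = norm (?S k - ?S j)"
      by (simp add: Suc)
    also have "\<dots> \<le> norm (?S k) + norm (?S j)"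
      by (rule norm_triangle_ineq4)
    also have "\<dots> \<le> 2 * K * norm (?S m)"
      using S[of k] S[of j] assms(2) Suc by simp
    finally show ?thesis .
  qed
qed

text \<open>Full coefficient sequences with eventually constant partial sums allow the expansions of
  different vectors to be subtracted without matching their lengths.\<close>

lemma span_range_expansion:
  fixes x :: "nat \<Rightarrow> 'a::real_vector"
  assumes "w \<in> span (range x)"
  shows "\<exists>a m. \<forall>n\<ge>m. (\<Sum>k\<le>n. a k *\<^sub>R x k) = w"
  using assms
proof (induction rule: span_induct_alt)
  case base
  show ?case
    by (intro exI[of _ "\<lambda>_. 0"]) simp
next
  case (step c v w)
  then obtain j a m where v: "v = x j" and w: "\<forall>n\<ge>m. (\<Sum>k\<le>n. a k *\<^sub>R x k) = w"
    by blast
  have "(\<Sum>k\<le>n. (a k + (if k = j then c else 0)) *\<^sub>R x k) = c *\<^sub>R v + w" if "n \<ge> max j m" for n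
  proof -
    have "(\<Sum>k\<le>n. (if k = j then c else 0) *\<^sub>R x k) = (\<Sum>k\<le>n. if k = j then c *\<^sub>R x k else 0)"
      by (intro sum.cong) auto
    then show ?thesis
      using that w by (simp add: scaleR_add_left sum.distrib v add.commute)
  qed
  then show ?case
    by (intro exI[of _ "\<lambda>k. a k + (if k = j then c else 0)"] exI[of _ "max j m"]) blast
qed

text \<open>Approximants \<open>w j\<close> from the span have coefficients \<open>A j k\<close>
  that are Cauchy in \<open>j\<close>, because \<open>basis_bound\<close> controls each coordinate.
  Their limits are the coefficients of \<open>l\<close>, since the partial sums are controlled
  uniformly in \<open>n\<close>.\<close>

lemma closed_span_expansion:
  fixes x :: "nat \<Rightarrow> 'a::real_normed_vector"
  assumes bb: "basis_bound x M" and nz: "\<And>k. x k \<noteq> 0" and l: "l \<in> closed_span x"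
  obtains a where "(\<lambda>n. \<Sum>k\<le>n. a k *\<^sub>R x k) \<longlonglongrightarrow> l"
proof -
  obtain w where w: "\<And>j. w j \<in> span (range x)" "w \<longlonglongrightarrow> l"
    using l unfolding closed_span_def closure_sequential by blast
  have "\<forall>j. \<exists>a m. \<forall>n\<ge>m. (\<Sum>k\<le>n. a k *\<^sub>R x k) = w j"
    using span_range_expansion w(1) by blast
  then obtain A m where A: "\<And>j n. n \<ge> m j \<Longrightarrow> (\<Sum>k\<le>n. A j k *\<^sub>R x k) = w j"
    by metis
  define S where "S a n = (\<Sum>k\<le>n. a k *\<^sub>R x k)" for a and n :: nat
  have diff: "(\<Sum>k\<le>n. (A j k - A i k) *\<^sub>R x k) = S (A j) n - S (A i) n" for i j n
    by (simp add: S_def scaleR_diff_left sum_subtractf)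
  have wdiff: "(\<Sum>k\<le>n. (A j k - A i k) *\<^sub>R x k) = w j - w i" if "n \<ge> m i" "n \<ge> m j" for i j n
    unfolding diff S_def using A that by simp
  have S_le: "norm (S (A j) n - S (A i) n) \<le> M * norm (w j - w i)" for i j n
  proof -
    \<comment> \<open>Beyond \<open>?N\<close> both finite expansions are exhausted, so the longer
      partial sum is exactly \<open>w j - w i\<close>.\<close>
    let ?N = "max n (max (m i) (m j))"
    have "norm (\<Sum>k\<le>n. (A j k - A i k) *\<^sub>R x k)
        \<le> M * norm (\<Sum>k\<le>?N. (A j k - A i k) *\<^sub>R x k)"
      by (rule basis_boundD[OF bb]) simp
    also have "(\<Sum>k\<le>?N. (A j k - A i k) *\<^sub>R x k) = w j - w i"
      by (rule wdiff) auto
    finally show ?thesis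
      unfolding diff .
  qed
  have term_le: "\<bar>A j k - A i k\<bar> * norm (x k) \<le> 2 * M * norm (w j - w i)" for i j k
  proof -
    let ?N = "max k (max (m i) (m j))"
    have "norm ((A j k - A i k) *\<^sub>R x k) \<le> 2 * M * norm (\<Sum>k\<le>?N. (A j k - A i k) *\<^sub>R x k)"
      by (rule basis_bound_term[OF bb, where a = "\<lambda>k. A j k - A i k"]) simp
    then show ?thesis
      by (simp add: wdiff[of i ?N j])
  qed
  have "Cauchy w"
    using w(2) by (rule LIMSEQ_imp_Cauchy)
  have "Cauchy (\<lambda>j. A j k)" for k
  proof (rule metric_CauchyI)
    fix e :: real assume e: "0 < e"
    \<comment> \<open>The denominator \<open>2 * \<bar>M\<bar> + 1\<close> is positive whatever the
      sign of \<open>M\<close>.\<close>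
    define e' where "e' = e * norm (x k) / (2 * \<bar>M\<bar> + 1)"
    have "e' > 0"
      using e nz by (simp add: e'_def add_nonneg_pos)
    then obtain N where N: "\<And>i j. i \<ge> N \<Longrightarrow> j \<ge> N \<Longrightarrow> dist (w i) (w j) < e'"
      using \<open>Cauchy w\<close> unfolding Cauchy_def by blast
    have "dist (A i k) (A j k) < e" if "i \<ge> N" "j \<ge> N" for i j
    proof -
      have "\<bar>A i k - A j k\<bar> * norm (x k) \<le> 2 * M * norm (w i - w j)"
        by (rule term_le)
      also have "\<dots> \<le> (2 * \<bar>M\<bar> + 1) * norm (w i - w j)"
        by (intro mult_right_mono) auto
      also have "\<dots> < (2 * \<bar>M\<bar> + 1) * e'"
        using N[OF that] by (intro mult_strict_left_mono) (auto simp: dist_norm)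
      also have "\<dots> = e * norm (x k)"
      proof -
        have "2 * \<bar>M\<bar> + 1 \<noteq> 0" by arith
        then show ?thesis unfolding e'_def by simp
      qed
      finally show ?thesis
        using nz[of k] by (simp add: dist_real_def)
    qed
    then show "\<exists>N. \<forall>i\<ge>N. \<forall>j\<ge>N. dist (A i k) (A j k) < e"
      by blast
  qed
  then have "\<forall>k. \<exists>b. (\<lambda>j. A j k) \<longlonglongrightarrow> b"
    using Cauchy_convergent convergent_def by blast
  then obtain a where a: "\<And>k. (\<lambda>j. A j k) \<longlonglongrightarrow> a k"
    by metis
  \<comment> \<open>Let \<open>i\<close> tend to infinity in \<open>S_le\<close> with
    \<open>n\<close> fixed: only finitely many coefficients are involved.\<close>
  have lim: "norm (S (A j) n - S a n) \<le> M * norm (w j - l)" for j n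
  proof (rule LIMSEQ_le)
    show "(\<lambda>i. norm (S (A j) n - S (A i) n)) \<longlonglongrightarrow> norm (S (A j) n - S a n)"
      unfolding S_def by (intro tendsto_intros a)
    show "(\<lambda>i. M * norm (w j - w i)) \<longlonglongrightarrow> M * norm (w j - l)"
      by (intro tendsto_intros w)
  qed (use S_le in blast)
  have "S a \<longlonglongrightarrow> l"
  proof (rule LIMSEQ_I)
    fix e :: real assume e: "0 < e"
    have "(\<lambda>j. (\<bar>M\<bar> + 1) * norm (w j - l)) \<longlonglongrightarrow> (\<bar>M\<bar> + 1) * norm (l - l)"
      by (intro tendsto_intros w)
    then have "\<forall>\<^sub>F j in sequentially. (\<bar>M\<bar> + 1) * norm (w j - l) < e"
      using e by (intro order_tendstoD) auto
    then obtain j where j: "(\<bar>M\<bar> + 1) * norm (w j - l) < e"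
      using eventually_happens'[OF sequentially_bot] by blast
    have "norm (S a n - l) < e" if "n \<ge> m j" for n
    proof -
      have "S a n - l = (w j - l) - (S (A j) n - S a n)"
        using A[OF that] by (simp add: S_def)
      then have "norm (S a n - l) \<le> norm (w j - l) + norm (S (A j) n - S a n)"
        by (simp only: norm_triangle_ineq4)
      also have "\<dots> \<le> norm (w j - l) + M * norm (w j - l)"
        using lim by simp
      also have "\<dots> \<le> (\<bar>M\<bar> + 1) * norm (w j - l)"
        by (simp add: distrib_right mult_right_mono)
      finally show ?thesis using j by simp
    qed
    then show "\<exists>no. \<forall>n\<ge>no. norm (S a n - l) < e"
      by blast
  qed
  then show thesis
    using that unfolding S_def by blast
qed

text \<open>Each term of the difference series is bounded by a multiple of the norms of its partial
  sums, which tend to 0.\<close>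

lemma basis_bound_expansion_unique:
  fixes x :: "nat \<Rightarrow> 'a::real_normed_vector"
  assumes bb: "basis_bound x M" and nz: "\<And>k. x k \<noteq> 0"
    and a: "(\<lambda>n. \<Sum>k\<le>n. a k *\<^sub>R x k) \<longlonglongrightarrow> l"
    and b: "(\<lambda>n. \<Sum>k\<le>n. b k *\<^sub>R x k) \<longlonglongrightarrow> l"
  shows "a k = b k"
proof -
  have "(\<lambda>n. \<Sum>k\<le>n. (a k - b k) *\<^sub>R x k) \<longlonglongrightarrow> 0"
    using tendsto_diff[OF a b] by (simp add: scaleR_diff_left sum_subtractf)
  then have lim: "(\<lambda>n. 2 * M * norm (\<Sum>k\<le>n. (a k - b k) *\<^sub>R x k)) \<longlonglongrightarrow> 2 * M * norm (0 :: 'a)"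
    by (intro tendsto_intros)
  have "norm ((a k - b k) *\<^sub>R x k) \<le> 2 * M * norm (0 :: 'a)"
    using basis_bound_term[OF bb, of k _ "\<lambda>k. a k - b k"]
    by (intro LIMSEQ_le_const[OF lim]) blast
  then show ?thesis
    using nz[of k] by (simp add: mult_le_0_iff)
qed

section \<open>Bibasic sequences\<close>

text \<open>The modulus of each partial sum lies below the supremum, and the norm is monotone. The
  bound obtained need not be the basis constant.\<close>

lemma bibasic_imp_basis_bound:
  assumes "bibasic x"
  obtains M where "basis_bound x M"
proof -
  obtain M where M: "\<And>(a :: nat \<Rightarrow> real) m. norm (Sup_fin ((\<lambda>n. \<bar>\<Sum>k\<le>n. a k *\<^sub>R x k\<bar>) ` {..m}))
          \<le> M * norm (\<Sum>k\<le>m. a k *\<^sub>R x k)"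
    using assms unfolding bibasic_def by blast
  have "norm (\<Sum>k\<le>n. a k *\<^sub>R x k) \<le> M * norm (\<Sum>k\<le>m. a k *\<^sub>R x k)" if "n \<le> m" for a n m
  proof -
    have "\<bar>\<Sum>k\<le>n. a k *\<^sub>R x k\<bar> \<le> Sup_fin ((\<lambda>n. \<bar>\<Sum>k\<le>n. a k *\<^sub>R x k\<bar>) ` {..m})"
      using that by (intro Sup_fin.coboundedI) auto
    then have "norm \<bar>\<Sum>k\<le>n. a k *\<^sub>R x k\<bar> \<le> norm (Sup_fin ((\<lambda>n. \<bar>\<Sum>k\<le>n. a k *\<^sub>R x k\<bar>) ` {..m}))"
      by (intro norm_mono_nonneg) auto
    then show ?thesis
      using M[of a m] by simp
  qed
  then show thesis
    using that unfolding basis_bound_def by blast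
qed

text \<open>The suprema of the tails need not exist in \<open>'a\<close>. Instead the partial sums are cut into
  finite blocks on which the series is geometrically small: the suprema over the blocks form an
  absolutely convergent series, whose tails dominate the error.\<close>

lemma bibasic_imp_series_order_converges:
  assumes "bibasic x" and lim: "(\<lambda>n. \<Sum>k\<le>n. a k *\<^sub>R x k) \<longlonglongrightarrow> l"
  shows "series_order_converges a x l"
proof -
  obtain M where "M \<ge> 1" and M: "\<And>(a :: nat \<Rightarrow> real) m. norm (Sup_fin ((\<lambda>n. \<bar>\<Sum>k\<le>n. a k *\<^sub>R x k\<bar>) ` {..m}))
          \<le> M * norm (\<Sum>k\<le>m. a k *\<^sub>R x k)"
    using assms(1) unfolding bibasic_def by blast
  define s where "s n = (\<Sum>k\<le>n. a k *\<^sub>R x k)" for n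
  have s: "s \<longlonglongrightarrow> l"
    using lim unfolding s_def .
  have "\<exists>N. \<forall>j. (\<forall>n\<ge>N j. norm (s n - l) < (1/2) ^ j) \<and> N j < N (Suc j)"
  proof (rule dependent_nat_choice)
    show "\<exists>N. \<forall>n\<ge>N. norm (s n - l) < (1/2) ^ 0"
      using LIMSEQ_D[OF s, of 1] by simp
    show "\<exists>N'. (\<forall>n\<ge>N'. norm (s n - l) < (1/2) ^ Suc j) \<and> N < N'" for N j
    proof -
      obtain N' where "\<forall>n\<ge>N'. norm (s n - l) < (1/2) ^ Suc j"
        using LIMSEQ_D[OF s, of "(1/2) ^ Suc j"] by auto
      then show ?thesis
        by (intro exI[of _ "max N' (Suc N)"]) auto
    qed
  qed
  then obtain N where N: "\<And>j n. n \<ge> N j \<Longrightarrow> norm (s n - l) < (1/2) ^ j"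
    and "\<And>j. N j < N (Suc j)"
    by blast
  then have mono: "strict_mono N"
    by (simp add: strict_mono_Suc_iff)
  \<comment> \<open>Deleting the terms up to \<open>N j\<close> makes the bibasic inequality apply
    to the block alone, with \<open>s (N (Suc j)) - s (N j)\<close> on its right-hand side.\<close>
  define b where "b j k = (if k \<le> N j then 0 else a k)" for j k
  have b: "(\<Sum>k\<le>n. b j k *\<^sub>R x k) = s n - s (N j)" if "n \<ge> N j" for n j
  proof -
    have "s n = (\<Sum>k\<le>n. b j k *\<^sub>R x k) + (\<Sum>k\<le>n. if k \<le> N j then a k *\<^sub>R x k else 0)"
      unfolding s_def b_def sum.distrib[symmetric] by (intro sum.cong) auto
    also have "(\<Sum>k\<le>n. if k \<le> N j then a k *\<^sub>R x k else 0) = s (N j)"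
      unfolding s_def using that by (intro sum.mono_neutral_cong_right) auto
    finally show ?thesis by simp
  qed
  define v where "v j = Sup_fin ((\<lambda>n. \<bar>\<Sum>k\<le>n. b j k *\<^sub>R x k\<bar>) ` {..N (Suc j)})" for j
  have v_ge: "\<bar>\<Sum>k\<le>n. b j k *\<^sub>R x k\<bar> \<le> v j" if "n \<le> N (Suc j)" for n j
    unfolding v_def using that by (intro Sup_fin.coboundedI) auto
  have v_nonneg: "0 \<le> v j" for j
    by (rule order_trans[OF abs_ge_zero v_ge[of 0]]) simp
  \<comment> \<open>\<open>v j\<close> bounds the movement within block \<open>j\<close>; the second
    summand is the distance of its starting point from \<open>l\<close>.\<close>
  define c where "c j = v j + \<bar>s (N j) - l\<bar>" for j
  have c_nonneg: "0 \<le> c j" for j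
    using v_nonneg by (simp add: c_def)
  \<comment> \<open>Both ends of the block are within \<open>(1/2) ^ j\<close> of \<open>l\<close>,
    which gives \<open>2 * M\<close> for \<open>v j\<close>; the starting point adds 1.\<close>
  have "norm (c j) \<le> (2 * M + 1) * (1/2) ^ j" for j
  proof -
    have lt: "N j \<le> N (Suc j)"
      using mono by (simp add: strict_mono_less_eq)
    have "norm (c j) \<le> norm (v j) + norm (s (N j) - l)"
      unfolding c_def by (rule order_trans[OF norm_triangle_ineq]) simp
    moreover have "norm (v j) \<le> M * norm (s (N (Suc j)) - s (N j))"
      unfolding v_def using M[of "b j" "N (Suc j)"] lt by (simp add: b)
    moreover have "norm (s (N (Suc j)) - s (N j)) \<le> 2 * (1/2) ^ j"
      using norm_triangle_ineq4[of "s (N (Suc j)) - l" "s (N j) - l"] N[of j "N (Suc j)"]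
        N[of j "N j"] lt by simp
    then have "M * norm (s (N (Suc j)) - s (N j)) \<le> M * (2 * (1/2) ^ j)"
      using \<open>M \<ge> 1\<close> by (intro mult_left_mono) auto
    ultimately show ?thesis
      using N[of j "N j"] by (simp add: algebra_simps)
  qed
  moreover have "summable (\<lambda>j. (2 * M + 1) * (1/2 :: real) ^ j)"
    by (intro summable_mult summable_geometric) simp
  ultimately have "summable c"
    by (intro summable_comparison_test'[of _ 0 c])
  then have "order_converges s l"
  proof (rule order_converges_tail[OF _ c_nonneg])
    fix i
    have "\<bar>s n - l\<bar> \<le> suminf c - sum c {..<i}" if n: "n \<ge> N i" for n
    proof -
      \<comment> \<open>\<open>N q\<close> is the first block boundary beyond \<open>n\<close>. As
        \<open>N i \<le> n\<close>, it has the form \<open>N (Suc j)\<close> with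
        \<open>i \<le> j\<close>, and \<open>n\<close> lies in block \<open>j\<close>.\<close>
      define q where "q = (LEAST q. n < N q)"
      have "n < N (Suc n)"
        using strict_mono_imp_increasing[OF mono, of "Suc n"] by simp
      then have q: "n < N q"
        unfolding q_def by (rule LeastI)
      then have "i < q"
        using n mono by (meson le_less_trans not_le strict_mono_less_eq)
      then obtain j where j: "q = Suc j" "i \<le> j"
        by (cases q) auto
      have "N j \<le> n"
        using not_less_Least[of j "\<lambda>q. n < N q"] j(1) unfolding q_def by simp
      have "\<bar>s n - l\<bar> = \<bar>(s n - s (N j)) + (s (N j) - l)\<bar>"
        by simp
      also have "\<dots> \<le> \<bar>s n - s (N j)\<bar> + \<bar>s (N j) - l\<bar>"
        by (rule abs_triangle_ineq)
      also have "\<dots> \<le> c j"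
        unfolding c_def using v_ge[of n j] b[OF \<open>N j \<le> n\<close>] q j(1) by (simp add: add_right_mono)
      finally have "\<bar>s n - l\<bar> + sum c {..<i} \<le> c j + sum c {..<i}"
        by (rule add_right_mono)
      also have "\<dots> \<le> c j + sum c {..<j}"
        using j(2) c_nonneg by (intro add_left_mono sum_mono2) auto
      also have "\<dots> = sum c {..<Suc j}"
        by (simp add: add.commute)
      also have "\<dots> \<le> suminf c"
        by (rule sum_le_suminf_lattice[OF \<open>summable c\<close> c_nonneg])
      finally show ?thesis
        by (simp add: le_diff_eq)
    qed
    then show "\<exists>n0. \<forall>n\<ge>n0. \<bar>s n - l\<bar> \<le> suminf c - sum c {..<i}"
      by blast
  qed
  then show ?thesis
    unfolding series_order_converges_def s_def .
qed

text \<open>One half of \<open>closed_span x = order_span x\<close> holds for every bibasic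
  sequence: a norm convergent expansion also converges in order.\<close>

lemma bibasic_closed_span_subset_order_span:
  assumes "bibasic x"
  shows "closed_span x \<subseteq> order_span x"
proof
  fix l assume l: "l \<in> closed_span x"
  have nz: "x k \<noteq> 0" for k
    using assms unfolding bibasic_def by blast
  obtain M where M: "basis_bound x M"
    using bibasic_imp_basis_bound[OF assms] .
  obtain a where "(\<lambda>n. \<Sum>k\<le>n. a k *\<^sub>R x k) \<longlonglongrightarrow> l"
    using closed_span_expansion[OF M nz l] .
  then show "l \<in> order_span x"
    using bibasic_imp_series_order_converges[OF assms] unfolding order_span_def by blast
qed

section \<open>Small perturbations\<close>

text \<open>Each perturbation term is the norm of \<open>a k *\<^sub>R x k\<close> times the
  relative error, and \<open>basis_bound_term\<close> bounds the former uniformly. Bounding the sum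
  of norms also controls the sum of moduli, as the lattice estimate requires.\<close>

lemma perturbation_bound:
  fixes x y :: "nat \<Rightarrow> 'a::real_normed_vector"
  assumes bb: "basis_bound x K" and nz: "\<And>k. x k \<noteq> 0"
    and sm: "summable (\<lambda>k. norm (x k - y k) / norm (x k))"
  shows "(\<Sum>k\<le>m. norm (a k *\<^sub>R (x k - y k)))
    \<le> 2 * K * (\<Sum>k. norm (x k - y k) / norm (x k)) * norm (\<Sum>k\<le>m. a k *\<^sub>R x k)"
proof -
  let ?s = "norm (\<Sum>k\<le>m. a k *\<^sub>R x k)"
  let ?r = "\<lambda>k. norm (x k - y k) / norm (x k)"
  have "norm (a k *\<^sub>R (x k - y k)) \<le> 2 * K * ?s * ?r k" if "k \<le> m" for k
  proof -
    have "norm (a k *\<^sub>R (x k - y k)) = norm (a k *\<^sub>R x k) * ?r k"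
      using nz by simp
    also have "\<dots> \<le> 2 * K * ?s * ?r k"
      by (intro mult_right_mono basis_bound_term[OF bb that]) simp
    finally show ?thesis .
  qed
  then have "(\<Sum>k\<le>m. norm (a k *\<^sub>R (x k - y k))) \<le> (\<Sum>k\<le>m. 2 * K * ?s * ?r k)"
    by (intro sum_mono) auto
  also have "\<dots> = 2 * K * ?s * (\<Sum>k\<le>m. ?r k)"
    by (simp add: sum_distrib_left)
  also have "\<dots> \<le> 2 * K * ?s * (\<Sum>k. ?r k)"
  proof (rule mult_left_mono)
    show "(\<Sum>k\<le>m. ?r k) \<le> (\<Sum>k. ?r k)"
      by (intro sum_le_suminf sm) auto
    show "0 \<le> 2 * K * ?s"
      using basis_bound_term[OF bb, of 0 m a] norm_ge_zero[of "a 0 *\<^sub>R x 0"]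
      by (meson le0 order_trans)
  qed
  finally show ?thesis
    by (simp add: mult_ac)
qed

theorem proposition9p9:
  fixes x y :: "nat \<Rightarrow> 'a::banach_lattice" and K :: real
  assumes "sester_basic x"
    and "is_basis_constant x K"
    and "summable (\<lambda>k. norm (x k - y k) / norm (x k))"
    and "2 * K * (\<Sum>k. norm (x k - y k) / norm (x k)) < 1"
  shows "sester_basic y"
proof -
  define \<theta> where "\<theta> = 2 * K * (\<Sum>k. norm (x k - y k) / norm (x k))"
  have "\<theta> < 1"
    using assms(4) unfolding \<theta>_def .
  have bx: "bibasic x" and ux: "unique_order_expansions x" and cx: "closed_span x = order_span x"
    using assms(1) unfolding sester_basic_def by auto
  have nz: "x k \<noteq> 0" for k
    using bx unfolding bibasic_def by blast
  have K: "basis_bound x K"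
    using assms(2) unfolding is_basis_constant_def by blast
  define X where "X a n = (\<Sum>k\<le>n. a k *\<^sub>R x k)" for a n
  define Y where "Y a n = (\<Sum>k\<le>n. a k *\<^sub>R y k)" for a n
  define D where "D a n = (\<Sum>k\<le>n. a k *\<^sub>R (x k - y k))" for a n
  have XYD: "X a n = Y a n + D a n" for a n
    by (simp add: X_def Y_def D_def scaleR_diff_right sum_subtractf)
  have pert: "(\<Sum>k\<le>m. norm (a k *\<^sub>R (x k - y k))) \<le> \<theta> * norm (X a m)" for a m
    unfolding \<theta>_def X_def by (rule perturbation_bound[OF K nz assms(3)])
  have XY: "(1 - \<theta>) * norm (X a m) \<le> norm (Y a m)" for a m
  proof -
    have "norm (X a m) \<le> norm (Y a m) + norm (D a m)"
      unfolding XYD by (rule norm_triangle_ineq)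
    also have "norm (D a m) \<le> \<theta> * norm (X a m)"
      unfolding D_def by (rule order_trans[OF norm_sum pert])
    finally show ?thesis
      by (simp add: algebra_simps)
  qed
  \<comment> \<open>The coefficient sequence of a single vector is inserted into \<open>XY\<close>.
    This comparison later transfers bounds on \<open>a k *\<^sub>R y k\<close> to
    \<open>a k *\<^sub>R x k\<close>.\<close>
  have single: "(1 - \<theta>) * norm (x k) \<le> norm (y k)" for k
  proof -
    have "X (\<lambda>i. if i = k then 1 else 0) k = x k" "Y (\<lambda>i. if i = k then 1 else 0) k = y k"
      unfolding X_def Y_def by (simp_all add: if_distrib[of "\<lambda>r. r *\<^sub>R _"] cong: if_cong)
    then show ?thesis
      using XY[of "\<lambda>i. if i = k then 1 else 0" k] by simp
  qed
  have nzy: "y k \<noteq> 0" for k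
  proof
    assume "y k = 0"
    then have "(1 - \<theta>) * norm (x k) \<le> 0"
      using single[of k] by simp
    then show False
      using \<open>\<theta> < 1\<close> nz[of k] by (simp add: mult_le_0_iff)
  qed
  have by': "bibasic y"
  proof -
    obtain M where "M \<ge> 1" and M: "\<And>a m. norm (Sup_fin ((\<lambda>n. \<bar>X a n\<bar>) ` {..m})) \<le> M * norm (X a m)"
      using bx unfolding bibasic_def X_def by blast
    \<comment> \<open>Passing from \<open>Y\<close> to \<open>X\<close> costs
      \<open>M + \<theta>\<close> times the norm of \<open>X a m\<close>, and returning by
      \<open>XY\<close> divides by \<open>1 - \<theta>\<close>. The maximum with 1 meets the
      requirement in \<open>bibasic\<close>.\<close>
    define M' where "M' = max 1 ((M + \<theta>) / (1 - \<theta>))"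
    have "norm (Sup_fin ((\<lambda>n. \<bar>Y a n\<bar>) ` {..m})) \<le> M' * norm (Y a m)" for a m
    proof -
      let ?SX = "Sup_fin ((\<lambda>n. \<bar>X a n\<bar>) ` {..m})" and ?SY = "Sup_fin ((\<lambda>n. \<bar>Y a n\<bar>) ` {..m})"
      \<comment> \<open>\<open>?E\<close> does not depend on \<open>n\<close> and dominates every
        \<open>\<bar>D a n\<bar>\<close> with \<open>n \<le> m\<close>, so it passes through the
        supremum.\<close>
      let ?E = "\<Sum>k\<le>m. \<bar>a k *\<^sub>R (x k - y k)\<bar>"
      have "?SY \<le> ?SX + ?E"
      proof (rule Sup_fin.boundedI)
        fix w assume "w \<in> (\<lambda>n. \<bar>Y a n\<bar>) ` {..m}"
        then obtain n where n: "n \<le> m" and w: "w = \<bar>Y a n\<bar>"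
          by auto
        have "w = \<bar>X a n - D a n\<bar>"
          unfolding w XYD by simp
        also have "\<dots> \<le> \<bar>X a n\<bar> + \<bar>D a n\<bar>"
          by (rule abs_triangle_ineq4)
        also have "\<dots> \<le> ?SX + ?E"
        proof (rule add_mono)
          show "\<bar>X a n\<bar> \<le> ?SX"
            using n by (intro Sup_fin.coboundedI) auto
          have "\<bar>D a n\<bar> \<le> (\<Sum>k\<le>n. \<bar>a k *\<^sub>R (x k - y k)\<bar>)"
            unfolding D_def by (rule sum_abs)
          also have "\<dots> \<le> ?E"
            using n by (intro sum_mono2) auto
          finally show "\<bar>D a n\<bar> \<le> ?E" .
        qed
        finally show "w \<le> ?SX + ?E" .
      qed auto
      moreover have "0 \<le> ?SY"
      proof (rule order_trans[OF abs_ge_zero])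
        show "\<bar>Y a 0\<bar> \<le> ?SY"
          by (intro Sup_fin.coboundedI) auto
      qed
      ultimately have "norm ?SY \<le> norm (?SX + ?E)"
        by (intro norm_mono_nonneg)
      also have "\<dots> \<le> norm ?SX + norm ?E"
        by (rule norm_triangle_ineq)
      also have "norm ?E \<le> (\<Sum>k\<le>m. norm (a k *\<^sub>R (x k - y k)))"
        by (rule order_trans[OF norm_sum]) simp
      also have "\<dots> \<le> \<theta> * norm (X a m)"
        by (rule pert)
      also have "norm ?SX \<le> M * norm (X a m)"
        by (rule M)
      also have "M * norm (X a m) + \<theta> * norm (X a m) = (M + \<theta>) / (1 - \<theta>) * ((1 - \<theta>) * norm (X a m))"
        using \<open>\<theta> < 1\<close> by (simp add: divide_simps) (simp add: algebra_simps)
      also have "\<dots> \<le> M' * norm (Y a m)"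
        unfolding M'_def using XY \<open>\<theta> < 1\<close> by (intro mult_mono) auto
      finally show ?thesis by simp
    qed
    moreover have "M' \<ge> 1"
      unfolding M'_def by simp
    ultimately show ?thesis
      using nzy unfolding bibasic_def Y_def[symmetric] by (intro conjI allI exI[of _ M']) auto
  qed
  obtain L where L: "basis_bound y L"
    using bibasic_imp_basis_bound[OF by'] .
  have norm_lim: "Y a \<longlonglongrightarrow> l" if "series_order_converges a y l" for a l
  proof -
    have oY: "order_converges (Y a) l"
      using that unfolding series_order_converges_def Y_def .
    then obtain B where B: "\<And>n. norm (Y a n) \<le> B"
      using order_converges_imp_Bseq unfolding Bseq_def by blast
    \<comment> \<open>Consecutive partial sums bound \<open>a k *\<^sub>R y k\<close> by
      \<open>2 * B\<close>; \<open>single\<close> turns this into a bound on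
      \<open>a k *\<^sub>R x k\<close>, and the relative errors supply summability.\<close>
    have "norm (a k *\<^sub>R (x k - y k)) \<le> 2 * B / (1 - \<theta>) * (norm (x k - y k) / norm (x k))" for k
    proof -
      have "norm (a k *\<^sub>R y k) \<le> 2 * B"
      proof (cases k)
        case 0
        then show ?thesis
          using B[of 0] order_trans[OF norm_ge_zero B[of 0]] unfolding Y_def by simp
      next
        case (Suc j)
        have "norm (a k *\<^sub>R y k) = norm (Y a k - Y a j)"
          by (simp add: Suc Y_def)
        also have "\<dots> \<le> 2 * B"
          using norm_triangle_ineq4[of "Y a k" "Y a j"] B[of k] B[of j] by simp
        finally show ?thesis .
      qed
      moreover have "\<bar>a k\<bar> * ((1 - \<theta>) * norm (x k)) \<le> \<bar>a k\<bar> * norm (y k)"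
        by (intro mult_left_mono single) simp
      ultimately have "norm (a k *\<^sub>R x k) \<le> 2 * B / (1 - \<theta>)"
        using \<open>\<theta> < 1\<close> by (simp add: pos_le_divide_eq mult_ac)
      then have "norm (a k *\<^sub>R x k) * (norm (x k - y k) / norm (x k))
          \<le> 2 * B / (1 - \<theta>) * (norm (x k - y k) / norm (x k))"
        by (intro mult_right_mono) auto
      then show ?thesis
        using nz[of k] by simp
    qed
    then have sm: "summable (\<lambda>k. norm (a k *\<^sub>R (x k - y k)))"
      by (intro summable_comparison_test'[OF summable_mult[OF assms(3), of "2 * B / (1 - \<theta>)"], of 0])
        simp
    define d where "d = (\<Sum>k. a k *\<^sub>R (x k - y k))"
    \<comment> \<open>The same vector \<open>d\<close> is the order limit and the norm limit of
      \<open>D a\<close>, so adding it in order and later subtracting it in norm returns to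
      \<open>l\<close>.\<close>
    have oD: "order_converges (D a) d"
      unfolding D_def d_def by (rule order_converges_absolutely[OF sm])
    have "order_converges (X a) (l + d)"
      using order_converges_add[OF oY oD] by (simp flip: XYD)
    then have oX: "series_order_converges a x (l + d)"
      unfolding series_order_converges_def X_def .
    then have "l + d \<in> closed_span x"
      unfolding cx order_span_def by blast
    then obtain b where b: "X b \<longlonglongrightarrow> l + d"
      using closed_span_expansion[OF K nz] unfolding X_def by blast
    then have "series_order_converges b x (l + d)"
      using bibasic_imp_series_order_converges[OF bx] unfolding X_def by blast
    \<comment> \<open>Uniqueness for \<open>x\<close> is what turns the order convergence of
      \<open>X a\<close> into norm convergence.\<close>
    then have "a = b"
      using ux oX unfolding unique_order_expansions_def by blast
    moreover have "D a \<longlonglongrightarrow> d"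
      using summable_LIMSEQ'[OF summable_norm_cancel[OF sm]] unfolding D_def d_def .
    ultimately have "(\<lambda>n. X a n - D a n) \<longlonglongrightarrow> l + d - d"
      using b by (intro tendsto_diff) auto
    then show ?thesis
      by (simp add: XYD)
  qed
  \<comment> \<open>By \<open>norm_lim\<close>, two order expansions of one vector are norm
    expansions of it, and these coincide because of \<open>L\<close>.\<close>
  have "unique_order_expansions y"
    unfolding unique_order_expansions_def
    using basis_bound_expansion_unique[OF L nzy] norm_lim unfolding Y_def by blast
  moreover have "order_span y \<subseteq> closed_span y"
  proof
    fix l assume "l \<in> order_span y"
    then obtain a where "Y a \<longlonglongrightarrow> l"
      using norm_lim unfolding order_span_def by blast
    moreover have "Y a n \<in> span (range y)" for n
      unfolding Y_def by (intro span_sum span_scale span_base) auto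
    ultimately show "l \<in> closed_span y"
      unfolding closed_span_def closure_sequential by blast
  qed
  ultimately show ?thesis
    unfolding sester_basic_def
    using by' bibasic_closed_span_subset_order_span[OF by'] by blast
qed

end
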